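(* For every integer $k\ge 29$, $\Gamma_{\rho}(P_k)=7$, where $P_k$ is the path on $k$ vertices.
   Context: $d(u,v)$ is graph distance. A packing coloring $c:V(G)\to\{1,\dots,k\}$ satisfies: $c(u)=c(v)=i$, $u\ne v$, implies $d(u,v)>i$. The Grundy packing chromatic number $\Gamma_{\rho}(G)$ is the maximum number of colors $k$ in a packing coloring $c:V(G)\to\{1,\dots,k\}$ using all $k$ colors in which every vertex $v$ with $c(v)=i$ has, for every $j\in\{1,\dots,i-1\}$, a vertex $u$ with $c(u)=j$ and $d(u,v)\le j$ (equivalently, the maximum number of colors produced by the greedy procedure that processes vertices in some order and assigns each vertex the smallest color $i$ with no already-colored vertex of color $i$ at distance at most $i$). *)

theory Defs
  imports "Graph_Theory.Graph_Theory"
begin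

text \<open>
  An undirected graph is a symmetric digraph, as in the locale \<open>graph\<close>. The graph distance is the
  shortest-path distance for unit weights; it is \<open>\<infinity>\<close> for vertices in different components.
\<close>

definition gdist :: "('a, 'b) pre_digraph \<Rightarrow> 'a \<Rightarrow> 'a \<Rightarrow> ereal" where
  "gdist G u v = wf_digraph.\<mu> G (\<lambda>_. 1) u v"

definition packing_coloring :: "('a, 'b) pre_digraph \<Rightarrow> nat \<Rightarrow> ('a \<Rightarrow> nat) \<Rightarrow> bool" where
  "packing_coloring G k c \<longleftrightarrow>
     c \<in> verts G \<rightarrow> {1..k} \<and>
     (\<forall>u\<in>verts G. \<forall>v\<in>verts G. \<forall>i. c u = i \<and> c v = i \<and> u \<noteq> v \<longrightarrow> gdist G u v > ereal (real i))"

definition grundy_packing_coloring :: "('a, 'b) pre_digraph \<Rightarrow> nat \<Rightarrow> ('a \<Rightarrow> nat) \<Rightarrow> bool" where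
  "grundy_packing_coloring G k c \<longleftrightarrow>
     packing_coloring G k c \<and>
     c ` verts G = {1..k} \<and>
     (\<forall>v\<in>verts G. \<forall>j\<in>{1..<c v}. \<exists>u\<in>verts G. c u = j \<and> gdist G u v \<le> ereal (real j))"

definition grundy_packing_chromatic_number :: "('a, 'b) pre_digraph \<Rightarrow> nat" where
  "grundy_packing_chromatic_number G = Max {k. \<exists>c. grundy_packing_coloring G k c}"

definition path_graph :: "nat \<Rightarrow> nat pair_pre_digraph" where
  "path_graph k =
     \<lparr> pverts = {1..k},
       parcs = {(i, j). i \<in> {1..k} \<and> j \<in> {1..k} \<and> (j = Suc i \<or> i = Suc j)} \<rparr>"

lemma pair_graph_path_graph: "pair_graph (path_graph k)"
proof
  have "parcs (path_graph k) \<subseteq> {1..k} \<times> {1..k}"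
    by (auto simp: path_graph_def)
  then show "finite (parcs (path_graph k))"
    by (rule finite_subset) simp
qed (auto simp: path_graph_def symmetric_def sym_def)

lemma finite_grundy_packing_colorings:
  assumes "finite (verts G)"
  shows "finite {k. \<exists>c. grundy_packing_coloring G k c}"
proof (rule finite_subset)
  show "{k. \<exists>c. grundy_packing_coloring G k c} \<subseteq> {..card (verts G)}"
  proof (intro subsetI, elim CollectE exE)
    fix k c assume "grundy_packing_coloring G k c"
    then have "c ` verts G = {1..k}"
      by (simp add: grundy_packing_coloring_def)
    then have "k = card (c ` verts G)"
      by simp
    then show "k \<in> {..card (verts G)}"
      using card_image_le[OF assms, of c] by simp
  qed
qed simp

end

theory Submission
  imports Defs
begin

text \<open>
  Whether colour 8 can occur is a local question: a vertex of colour 8 has a neighbour of colour 1,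
  and growing the word 81 alternately at its two ends always runs into a violated distance or
  greediness condition after at most 17 steps. So no path needs more than 7 colours. Conversely, a
  colouring of the path on 29 vertices with 7 colours extends greedily vertex by vertex, and the
  upper bound guarantees that the extension never introduces an eighth colour.
\<close>

section \<open>Distance in paths\<close>

lemma pverts_path_graph: "pverts (path_graph n) = {1..n}"
  by (simp add: path_graph_def)

lemma awalk_path_graph_dist_le_length:
  assumes "pre_digraph.awalk (with_proj (path_graph n)) u p v"
  shows "\<bar>real u - real v\<bar> \<le> real (length p)"
proof -
  interpret pair_graph "path_graph n" by (rule pair_graph_path_graph)
  show ?thesis
    using assms
  proof (induction p arbitrary: u)
    case Nil
    then show ?case by (simp add: awalk_Nil_iff)
  next
    case (Cons e p)
    then have "\<bar>real (snd e) - real v\<bar> \<le> real (length p)" "fst e = u" "e \<in> parcs (path_graph n)"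
      by (auto simp: awalk_Cons_iff)
    moreover from this(2,3) have "\<bar>real u - real (snd e)\<bar> \<le> 1"
      by (auto simp: path_graph_def)
    ultimately show ?case by simp
  qed
qed

lemma ex_awalk_path_graph:
  assumes "u \<in> {1..n}" "v \<in> {1..n}"
  shows "\<exists>p. pre_digraph.awalk (with_proj (path_graph n)) u p v \<and>
    real (length p) = \<bar>real u - real v\<bar>"
proof -
  interpret pair_graph "path_graph n" by (rule pair_graph_path_graph)
  show ?thesis
    using assms(1)
  proof (induction "nat \<bar>int u - int v\<bar>" arbitrary: u)
    case 0
    then have "u = v" by simp
    with assms show ?case
      by (intro exI[of _ "[]"]) (simp add: awalk_Nil_iff pverts_path_graph)
  next
    case (Suc d)
    define u' where "u' = (if u < v then u + 1 else u - 1)"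
    have u': "d = nat \<bar>int u' - int v\<bar>" "u' \<in> {1..n}" "\<bar>real u - real v\<bar> = 1 + \<bar>real u' - real v\<bar>"
      and arc: "(u, u') \<in> parcs (path_graph n)"
      using Suc.hyps(2) Suc.prems assms(2) by (auto simp: u'_def path_graph_def split: if_splits)
    from Suc.hyps(1)[OF u'(1,2)] obtain p where
      "awalk u' p v" "real (length p) = \<bar>real u' - real v\<bar>"
      by blast
    with u'(3) arc Suc.prems show ?case
      by (intro exI[of _ "(u, u') # p"]) (auto simp: awalk_Cons_iff)
  qed
qed

text \<open>Every arc changes the position by one, so no walk is shorter than the difference of the
  labels, and a walk straight towards \<open>v\<close> attains it; the infimum over walk costs is
  therefore this difference.\<close>

lemma gdist_path_graph:
  assumes "u \<in> {1..n}" "v \<in> {1..n}"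
  shows "gdist (with_proj (path_graph n)) u v = ereal \<bar>real u - real v\<bar>"
proof -
  interpret pair_graph "path_graph n" by (rule pair_graph_path_graph)
  have cost: "awalk_cost (\<lambda>_. 1) p = real (length p)" for p
    by (simp add: awalk_cost_def sum_list_triv)
  obtain p where p: "awalk u p v" "real (length p) = \<bar>real u - real v\<bar>"
    using ex_awalk_path_graph[OF assms] by blast
  show ?thesis
    unfolding gdist_def
  proof (rule antisym)
    show "\<mu> (\<lambda>_. 1) u v \<le> ereal \<bar>real u - real v\<bar>"
      using min_cost_le_walk_cost[OF p(1), of "\<lambda>_. 1"] p(2) by (simp add: cost)
    show "ereal \<bar>real u - real v\<bar> \<le> \<mu> (\<lambda>_. 1) u v"
      unfolding \<mu>_def by (rule INF_greatest) (auto simp: cost intro: awalk_path_graph_dist_le_length)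
  qed
qed

lemma grundy_packing_coloring_path_graph_iff:
  "grundy_packing_coloring (with_proj (path_graph n)) k c \<longleftrightarrow>
     c ` {1..n} = {1..k} \<and>
     (\<forall>u\<in>{1..n}. \<forall>v\<in>{1..n}. c u = c v \<and> u \<noteq> v \<longrightarrow> int (c u) < \<bar>int u - int v\<bar>) \<and>
     (\<forall>v\<in>{1..n}. \<forall>j\<in>{1..<c v}. \<exists>u\<in>{1..n}. c u = j \<and> \<bar>int u - int v\<bar> \<le> int j)"
proof -
  have less: "ereal (real i) < gdist (with_proj (path_graph n)) u v \<longleftrightarrow> int i < \<bar>int u - int v\<bar>"
    and le: "gdist (with_proj (path_graph n)) u v \<le> ereal (real i) \<longleftrightarrow> \<bar>int u - int v\<bar> \<le> int i"
    if "u \<in> {1..n}" "v \<in> {1..n}" for u v i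
    unfolding gdist_path_graph[OF that] by auto
  show ?thesis
    unfolding grundy_packing_coloring_def packing_coloring_def with_proj_simps pverts_path_graph
    using less le by (auto 0 4 simp: Pi_iff)
qed

section \<open>Greedy extension by one vertex\<close>

text \<open>The new end vertex gets the first colour that fits. Distances between old vertices do
  not change, so their conditions persist, and each smaller colour is blocked by an old vertex,
  which is the witness that greediness requires.\<close>

lemma grundy_packing_coloring_path_graph_Suc:
  assumes "grundy_packing_coloring (with_proj (path_graph n)) k c"
  shows "\<exists>k' c'. k \<le> k' \<and> grundy_packing_coloring (with_proj (path_graph (Suc n))) k' c'"
proof -
  have c_image: "c ` {1..n} = {1..k}"
    and c_packing: "\<And>u v. u \<in> {1..n} \<Longrightarrow> v \<in> {1..n} \<Longrightarrow> c u = c v \<Longrightarrow> u \<noteq> v \<Longrightarrow>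
      int (c u) < \<bar>int u - int v\<bar>"
    and c_greedy: "\<And>v j. v \<in> {1..n} \<Longrightarrow> j \<in> {1..<c v} \<Longrightarrow>
      \<exists>u\<in>{1..n}. c u = j \<and> \<bar>int u - int v\<bar> \<le> int j"
    using assms unfolding grundy_packing_coloring_path_graph_iff by blast+
  define free where "free i \<longleftrightarrow> 1 \<le> i \<and> (\<forall>u\<in>{1..n}. c u = i \<longrightarrow> int i < \<bar>int u - int (Suc n)\<bar>)" for i
  define i where "i = (LEAST i. free i)"
  define c' where "c' = c(Suc n := i)"
  have "free (Suc k)"
    using c_image by (force simp: free_def)
  then have i: "free i" "i \<le> Suc k" and least: "\<And>j. j < i \<Longrightarrow> \<not> free j"
    unfolding i_def by (auto intro: LeastI Least_le dest: not_less_Least)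
  have S: "{1..Suc n} = insert (Suc n) {1..n}"
    by auto
  have c'_old: "c' u = c u" if "u \<in> {1..n}" for u
    using that by (simp add: c'_def)
  have c'_new: "c' (Suc n) = i"
    by (simp add: c'_def)
  have "c' ` {1..Suc n} = insert i (c ` {1..n})"
    unfolding S using c'_old c'_new by (auto simp del: atLeastAtMost_iff)
  \<comment> \<open>As 1 \<le> i \<le> k + 1, adding \<open>i\<close> leaves no gap among the
    colours.\<close>
  also have "\<dots> = {1..max k i}"
    using c_image i by (auto simp: free_def)
  finally have image: "c' ` {1..Suc n} = {1..max k i}" .
  have packing: "int (c' u) < \<bar>int u - int v\<bar>"
    if uv: "u \<in> {1..Suc n}" "v \<in> {1..Suc n}" "c' u = c' v" "u \<noteq> v" for u v
  proof -
    consider "u \<in> {1..n}" "v \<in> {1..n}" | "u = Suc n" "v \<in> {1..n}" | "u \<in> {1..n}" "v = Suc n"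
      using uv(1,2,4) unfolding S by blast
    then show ?thesis
    proof cases
      case 1
      then show ?thesis using c_packing uv c'_old by simp
    next
      case 2
      then show ?thesis using i(1) uv(3) c'_old[of v] c'_new by (auto simp: free_def)
    next
      case 3
      then show ?thesis using i(1) uv(3) c'_old[of u] c'_new by (auto simp: free_def)
    qed
  qed
  have greedy: "\<exists>u\<in>{1..Suc n}. c' u = j \<and> \<bar>int u - int v\<bar> \<le> int j"
    if "v \<in> {1..Suc n}" "j \<in> {1..<c' v}" for v j
  proof -
    have "\<exists>u\<in>{1..n}. c u = j \<and> \<bar>int u - int v\<bar> \<le> int j"
    proof (cases "v = Suc n")
      case True
      then have "\<not> free j"
        using that c'_new least by simp
      with True that show ?thesis
        by (auto simp: free_def not_less)
    next
      case False
      then have "v \<in> {1..n}"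
        using that by auto
      with that c_greedy c'_old show ?thesis
        by simp
    qed
    then show ?thesis
      unfolding S using c'_old by fastforce
  qed
  have "grundy_packing_coloring (with_proj (path_graph (Suc n))) (max k i) c'"
    unfolding grundy_packing_coloring_path_graph_iff using image packing greedy by blast
  then show ?thesis
    using max.cobounded1 by blast
qed

section \<open>Colour 8 does not occur\<close>

text \<open>
  Value 0 stands both for positions outside the path and for colours above 8; neither is subject
  to any condition.
\<close>

definition clipped_grundy :: "(int \<Rightarrow> nat) \<Rightarrow> bool" where
  "clipped_grundy f \<longleftrightarrow>
     (\<forall>v. f v \<le> 8) \<and>
     (\<forall>u v. 0 < f u \<and> f u = f v \<and> u \<noteq> v \<longrightarrow> int (f u) < \<bar>u - v\<bar>) \<and>
     (\<forall>v j. 1 \<le> j \<and> j < f v \<longrightarrow> (\<exists>u. f u = j \<and> \<bar>u - v\<bar> \<le> int j))"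

text \<open>Positions are integers and \<open>f\<close> is total, so an occurring word can always be
  extended at both ends, possibly by 0.\<close>

definition occurs :: "nat list \<Rightarrow> bool" where
  "occurs w \<longleftrightarrow> (\<exists>f p. clipped_grundy f \<and> (\<forall>i<length w. w ! i = f (p + int i)))"

text \<open>
  Only the distance condition of the first letter and the greediness conditions whose window is a
  prefix of the word are tested: words are extended one letter at a time and reversed in between,
  so every window is a prefix at the moment it is completed.
\<close>

definition inconsistent :: "nat list \<Rightarrow> bool" where
  "inconsistent w \<longleftrightarrow> hd w \<in> set (take (hd w) (tl w)) \<or>
     (let n = length w in
       \<exists>j\<in>set [1,2,3,4,5,6,7]. 2 * j < n \<and> j < w ! j \<and> j \<notin> set (take (2 * j + 1) w))"

text \<open>Exhaustive search of depth \<open>n\<close>; a branch that survives to depth 0 refutes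
  nothing. The reversal makes the next letter go to the other end.\<close>

fun refutable :: "nat \<Rightarrow> nat list \<Rightarrow> bool" where
  "refutable 0 w \<longleftrightarrow> False"
| "refutable (Suc n) w \<longleftrightarrow>
     (\<forall>c\<in>set [0,1,2,3,4,5,6,7,8]. inconsistent (c # w) \<or> refutable n (rev (c # w)))"

lemma clipped_grundyD:
  assumes "clipped_grundy f"
  shows "f v \<le> 8"
    and "0 < f u \<Longrightarrow> f u = f v \<Longrightarrow> u \<noteq> v \<Longrightarrow> int (f u) < \<bar>u - v\<bar>"
    and "1 \<le> j \<Longrightarrow> j < f v \<Longrightarrow> \<exists>u. f u = j \<and> \<bar>u - v\<bar> \<le> int j"
  using assms unfolding clipped_grundy_def by blast+

lemma occursI:
  assumes "clipped_grundy f" "\<And>i. i < length w \<Longrightarrow> w ! i = f (p + int i)"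
  shows "occurs w"
  using assms unfolding occurs_def by blast

text \<open>All conditions depend on positions only through \<bar>u - v\<bar>, so they survive the
  reflection of the integers at 0.\<close>

lemma occurs_rev:
  assumes "occurs w"
  shows "occurs (rev w)"
proof -
  from assms obtain f p where f: "clipped_grundy f" and w: "\<And>i. i < length w \<Longrightarrow> w ! i = f (p + int i)"
    by (auto simp: occurs_def)
  have "clipped_grundy (\<lambda>x. f (- x))"
    unfolding clipped_grundy_def
  proof (intro conjI allI impI)
    show "f (- v) \<le> 8" for v
      by (rule clipped_grundyD(1)[OF f])
    show "int (f (- u)) < \<bar>u - v\<bar>" if "0 < f (- u) \<and> f (- u) = f (- v) \<and> u \<noteq> v" for u v
      using clipped_grundyD(2)[OF f, of "- u" "- v"] that by simp
    show "\<exists>u. f (- u) = j \<and> \<bar>u - v\<bar> \<le> int j" if j: "1 \<le> j \<and> j < f (- v)" for v j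
    proof -
      obtain u where "f u = j" "\<bar>u - - v\<bar> \<le> int j"
        using clipped_grundyD(3)[OF f, of j "- v"] j by blast
      then show ?thesis
        by (intro exI[of _ "- u"]) auto
    qed
  qed
  \<comment> \<open>The last letter of \<open>w\<close>, at p + length w - 1, is reflected to the
    start of the reversed word.\<close>
  moreover have "rev w ! i = f (- ((- p - int (length w - 1)) + int i))" if "i < length (rev w)" for i
  proof -
    have "- (- p - int (length w - 1) + int i) = p + int (length w - Suc i)"
      using that by simp
    then show ?thesis
      using that by (simp add: rev_nth w algebra_simps)
  qed
  ultimately show ?thesis
    by (rule occursI)
qed

lemma occurs_Cons:
  assumes "occurs w"
  shows "\<exists>c\<le>8. occurs (c # w)"
proof -
  from assms obtain f p where f: "clipped_grundy f" and w: "\<And>i. i < length w \<Longrightarrow> w ! i = f (p + int i)"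
    by (auto simp: occurs_def)
  have "(f (p - 1) # w) ! i = f (p - 1 + int i)" if "i < length (f (p - 1) # w)" for i
    using that w by (cases i) auto
  with f have "occurs (f (p - 1) # w)"
    by (rule occursI)
  then show ?thesis
    using clipped_grundyD(1)[OF f] by blast
qed

lemma occurs_imp_not_inconsistent:
  assumes "occurs w" "w \<noteq> []"
  shows "\<not> inconsistent w"
proof
  assume "inconsistent w"
  from assms obtain f p where f: "clipped_grundy f" and w: "\<And>i. i < length w \<Longrightarrow> w ! i = f (p + int i)"
    by (auto simp: occurs_def)
  have "\<forall>j\<in>set [1,2,3,4,5,6,7::nat]. 1 \<le> j"
    by simp
  with \<open>inconsistent w\<close> consider
      "hd w \<in> set (take (hd w) (tl w))"
    | j where "1 \<le> j" "2 * j < length w" "j < w ! j" "j \<notin> set (take (2 * j + 1) w)"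
    unfolding inconsistent_def Let_def by blast
  then show False
  proof cases
    case 1
    then obtain i where i: "i < hd w" "i < length (tl w)" "tl w ! i = hd w"
      by (auto simp: in_set_conv_nth)
    have "f p = hd w"
      using w[of 0] assms(2) by (simp add: hd_conv_nth)
    moreover have "f (p + int (Suc i)) = hd w"
      using w[of "Suc i"] i by (simp add: nth_tl)
    \<comment> \<open>The uncoloured value 0 is excluded here by \<open>i < hd w\<close>.\<close>
    ultimately have "int (hd w) < \<bar>p - (p + int (Suc i))\<bar>"
      using clipped_grundyD(2)[OF f, of p "p + int (Suc i)"] i(1) by simp
    with i(1) show False
      by simp
  next
    case 2
    then have "j < f (p + int j)"
      using w[of j] by simp
    then obtain u where u: "f u = j" "\<bar>u - (p + int j)\<bar> \<le> int j"
      using clipped_grundyD(3)[OF f 2(1)] by blast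
    \<comment> \<open>The positions within distance \<open>j\<close> of p + j are p, ..., p + 2j,
      exactly those of the tested prefix.\<close>
    define i where "i = nat (u - p)"
    have i: "u = p + int i" "i < 2 * j + 1"
      using u(2) by (auto simp: i_def)
    then have "take (2 * j + 1) w ! i = j" "i < length (take (2 * j + 1) w)"
      using w[of i] u(1) 2(2) by auto
    with 2(4) show False
      by (metis nth_mem)
  qed
qed

lemma refutable_imp_not_occurs: "refutable n w \<Longrightarrow> \<not> occurs w"
proof (induction n arbitrary: w)
  case 0
  then show ?case by simp
next
  case (Suc n)
  show ?case
  proof
    assume "occurs w"
    then obtain c where c: "c \<le> 8" "occurs (c # w)"
      using occurs_Cons by blast
    then have "c \<in> set [0,1,2,3,4,5,6,7,8]"
      by auto
    with Suc.prems have "inconsistent (c # w) \<or> refutable n (rev (c # w))"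
      unfolding refutable.simps by blast
    with c(2) Suc.IH show False
      using occurs_imp_not_inconsistent occurs_rev by blast
  qed
qed

text \<open>A finite search, by evaluation, through words of at most 19 letters.\<close>

lemma refutable_8_1: "refutable 17 [8, 1]"
  by code_simp

text \<open>Greediness puts a 1 next to any 8, and by reflection it may be taken on the
  right.\<close>

lemma clipped_grundy_neq_8:
  assumes "clipped_grundy f"
  shows "f v \<noteq> 8"
proof
  assume "f v = 8"
  then obtain u where u: "f u = 1" "\<bar>u - v\<bar> \<le> 1"
    using clipped_grundyD(3)[OF assms, of 1 v] by auto
  with \<open>f v = 8\<close> have "u = v - 1 \<or> u = v + 1"
    by (cases "u = v") auto
  then have "occurs [8, 1]"
  proof
    assume "u = v - 1"
    with u \<open>f v = 8\<close> have "[1, 8] ! i = f (u + int i)" if "i < length [1, 8::nat]" for i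
      using that by (auto simp: less_Suc_eq)
    with assms have "occurs [1, 8]"
      by (rule occursI)
    then show ?thesis
      using occurs_rev[of "[1, 8]"] by simp
  next
    assume "u = v + 1"
    with u \<open>f v = 8\<close> have "[8, 1] ! i = f (v + int i)" if "i < length [8, 1::nat]" for i
      using that by (auto simp: less_Suc_eq)
    with assms show ?thesis
      by (rule occursI)
  qed
  then show False
    using refutable_imp_not_occurs[OF refutable_8_1] by blast
qed

lemma grundy_packing_coloring_path_graph_le_7:
  assumes "grundy_packing_coloring (with_proj (path_graph n)) k c"
  shows "k \<le> 7"
proof (rule ccontr)
  assume "\<not> k \<le> 7"
  have c_image: "c ` {1..n} = {1..k}"
    and c_packing: "\<And>u v. u \<in> {1..n} \<Longrightarrow> v \<in> {1..n} \<Longrightarrow> c u = c v \<Longrightarrow> u \<noteq> v \<Longrightarrow>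
      int (c u) < \<bar>int u - int v\<bar>"
    and c_greedy: "\<And>v j. v \<in> {1..n} \<Longrightarrow> j \<in> {1..<c v} \<Longrightarrow>
      \<exists>u\<in>{1..n}. c u = j \<and> \<bar>int u - int v\<bar> \<le> int j"
    using assms unfolding grundy_packing_coloring_path_graph_iff by blast+
  \<comment> \<open>For negative \<open>x\<close>, \<open>nat x\<close> is 0, which is not a vertex,
    so \<open>f\<close> vanishes there as well.\<close>
  define f where "f x = (if nat x \<in> {1..n} \<and> c (nat x) \<le> 8 then c (nat x) else 0)" for x
  have f_pos: "nat x \<in> {1..n} \<and> c (nat x) = f x \<and> 0 \<le> x" if "0 < f x" for x
    using that by (auto simp: f_def split: if_splits)
  have "clipped_grundy f"
    unfolding clipped_grundy_def
  proof (intro conjI allI impI)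
    show "f v \<le> 8" for v
      by (simp add: f_def)
    show "int (f u) < \<bar>u - v\<bar>" if "0 < f u \<and> f u = f v \<and> u \<noteq> v" for u v
      using f_pos[of u] f_pos[of v] that c_packing[of "nat u" "nat v"] by (simp add: eq_nat_nat_iff)
    show "\<exists>u. f u = j \<and> \<bar>u - v\<bar> \<le> int j" if "1 \<le> j \<and> j < f v" for v j
    proof -
      have v: "nat v \<in> {1..n}" "c (nat v) = f v" "0 \<le> v"
        using f_pos[of v] that by auto
      moreover have "j \<in> {1..<c (nat v)}"
        using v that by simp
      ultimately obtain u where u: "u \<in> {1..n}" "c u = j" "\<bar>int u - v\<bar> \<le> int j"
        using c_greedy[of "nat v" j] by auto
      \<comment> \<open>The witness has a colour below \<open>f v\<close>, hence it survives the
        clipping.\<close>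
      have "j \<le> 8"
        using that by (auto simp: f_def split: if_splits)
      with u show ?thesis
        by (intro exI[of _ "int u"]) (simp add: f_def)
    qed
  qed
  moreover have "8 \<in> c ` {1..n}"
    using c_image \<open>\<not> k \<le> 7\<close> by simp
  then obtain v where "v \<in> {1..n}" "c v = 8"
    by auto
  then have "f (int v) = 8"
    by (simp add: f_def)
  ultimately show False
    using clipped_grundy_neq_8 by blast
qed

section \<open>Colour 7 occurs\<close>

lemma ex_grundy_packing_coloring_path_graph_29:
  "\<exists>c. grundy_packing_coloring (with_proj (path_graph 29)) 7 c"
proof -
  define c :: "nat \<Rightarrow> nat" where
    \<comment> \<open>Vertices are numbered from 1, list entries from 0. The only 7 is at vertex 13
      and the only 6 at vertex 19, just within reach.\<close>
    "c i = [4,1,2,3,1,4,2,1,5,3,1,2,7,1,4,2,1,3,6,1,2,1,5,3,1,2,4,1,2] ! (i - 1)" for i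
  have image: "c ` {1..29} = {1..7}"
    unfolding c_def by code_simp
  \<comment> \<open>Ordered pairs and addition of naturals make the condition a finite computation;
    the symmetric form with integers follows.\<close>
  have later: "\<forall>v\<in>{1..29}. \<forall>u\<in>{1..<v}. c u = c v \<longrightarrow> u + c u < v"
    unfolding c_def by code_simp
  have packing: "int (c u) < \<bar>int u - int v\<bar>"
    if "u \<in> {1..29}" "v \<in> {1..29}" "c u = c v" "u \<noteq> v" for u v
    using later[rule_format, of v u] later[rule_format, of u v] that
    by (cases u v rule: linorder_cases) auto
  have "\<forall>v\<in>{1..29}. \<forall>j\<in>{1..<c v}. \<exists>u\<in>{1..29}. c u = j \<and> u \<le> v + j \<and> v \<le> u + j"
    unfolding c_def by code_simp
  moreover have "\<bar>int u - int v\<bar> \<le> int j \<longleftrightarrow> u \<le> v + j \<and> v \<le> u + j" for u v j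
    by auto
  ultimately show ?thesis
    unfolding grundy_packing_coloring_path_graph_iff using image packing by blast
qed

lemma ex_grundy_packing_coloring_path_graph:
  assumes "29 \<le> n"
  shows "\<exists>c. grundy_packing_coloring (with_proj (path_graph n)) 7 c"
  using assms
proof (induction n rule: nat_induct_at_least)
  case base
  show ?case by (rule ex_grundy_packing_coloring_path_graph_29)
next
  \<comment> \<open>The extension has at least 7 colours, and the upper bound makes it exactly
    7.\<close>
  case (Suc n)
  then show ?case
    using grundy_packing_coloring_path_graph_Suc grundy_packing_coloring_path_graph_le_7
    by (metis le_antisym)
qed

theorem theorem22:
  fixes k :: nat
  assumes "k \<ge> 29"
  shows "grundy_packing_chromatic_number (with_proj (path_graph k)) = 7"
  unfolding grundy_packing_chromatic_number_def
proof (rule Max_eqI)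
  show "finite {m. \<exists>c. grundy_packing_coloring (with_proj (path_graph k)) m c}"
    by (rule finite_grundy_packing_colorings) (simp add: path_graph_def)
  show "m \<le> 7" if "m \<in> {m. \<exists>c. grundy_packing_coloring (with_proj (path_graph k)) m c}" for m
    using that grundy_packing_coloring_path_graph_le_7 by blast
  show "7 \<in> {m. \<exists>c. grundy_packing_coloring (with_proj (path_graph k)) m c}"
    using ex_grundy_packing_coloring_path_graph[OF assms] by blast
qed

end
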